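(* (1) Let $X$ be an infinite finitely supported subset of an invariant set $Y$. Then the sets $\wp_{fs}(\wp_{fin}(X))$ and $\wp_{fs}(T_{fin}(X))$ are FSM uniformly infinite. (2) Let $X$ be an infinite finitely supported subset of an invariant set $Y$. Then $\wp_{fs}(\wp_{fs}(X))$ is FSM uniformly infinite. (3) Let $X$ and $Y$ be finitely supported subsets of an invariant set $Z$. If neither $X$ nor $Y$ is FSM uniformly infinite, then $X\times Y$ is not FSM uniformly infinite. (4) Let $X$ and $Y$ be finitely supported subsets of an invariant set $Z$. If neither $X$ nor $Y$ is FSM uniformly infinite, then the disjoint union $X+Y$ is not FSM uniformly infinite.
   Context: Fix an infinite set $A$ of atoms. $S_A$ is the group of bijections of $A$ that are compositions of finitely many transpositions. An $S_A$-set is a set with a group action $\cdot$ of $S_A$. For $S\subseteq A$, $Fix(S)=\{\pi\in S_A:\pi(a)=a\ \forall a\in S\}$; $S$ supports $x$ if $\pi\cdot x=x$ for all $\pi\in Fix(S)$; the least finite supporting set of $x$ is $supp(x)$. An invariant set is an $S_A$-set all of whose elements have finite supporting sets. Powersets carry $\pi\star Z=\{\pi\cdot z:z\in Z\}$; for an invariant set $Y$, $\wp_{fs}(Y)$ is the (invariant) set of subsets of $Y$ finitely supported under $\star$; its elements are the finitely supported subsets of $Y$; if $X\in\wp_{fs}(Y)$, $\wp_{fs}(X)=\{Z\in\wp_{fs}(Y):Z\subseteq X\}$, and similarly for finitely supported subsets of $\wp_{fs}(Y)$. Cartesian products carry the componentwise action; the disjoint union $X+Y=\{(0,x):x\in X\}\cup\{(1,y):y\in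 Y\}$ carries $\pi\cdot(0,x)=(0,\pi\cdot x)$, $\pi\cdot(1,y)=(1,\pi\cdot y)$. $\wp_{fin}(X)$ is the set of finite subsets of $X$ (a subset of $\wp_{fs}(Y)$ supported by $supp(X)$). $T_{fin}(X)$ is the set of all finite injective tuples (tuples with pairwise distinct entries) of elements of $X$, with componentwise action (a subset of the invariant set $\bigcup_n Y^n$). A set is uniformly supported if one finite $S\subseteq A$ supports all its elements. A finitely supported subset of an invariant set is FSM uniformly infinite if it contains an infinite uniformly supported subset. *)

theory Defs
  imports "HOL-Algebra.Group_Action" "HOL-Combinatorics.Permutations"
begin

text \<open>
  The atoms are the elements of the type \<open>'a\<close>; that there are infinitely many of them is an
  explicit hypothesis wherever it is needed. The library predicate \<^const>\<open>permutation\<close>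
  says that a function is a composition of finitely many transpositions.
\<close>

definition atom_perms :: "('a \<Rightarrow> 'a) monoid"
  where "atom_perms = \<lparr>carrier = {\<pi>. permutation \<pi>}, monoid.mult = (\<circ>), one = id\<rparr>"

definition Fix :: "'a set \<Rightarrow> ('a \<Rightarrow> 'a) set"
  where "Fix S = {\<pi> \<in> carrier atom_perms. \<forall>a\<in>S. \<pi> a = a}"

definition supports :: "(('a \<Rightarrow> 'a) \<Rightarrow> 'b \<Rightarrow> 'b) \<Rightarrow> 'a set \<Rightarrow> 'b \<Rightarrow> bool"
  where "supports act S x \<longleftrightarrow> (\<forall>\<pi>\<in>Fix S. act \<pi> x = x)"

definition finitely_supported :: "(('a \<Rightarrow> 'a) \<Rightarrow> 'b \<Rightarrow> 'b) \<Rightarrow> 'b \<Rightarrow> bool"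
  where "finitely_supported act x \<longleftrightarrow> (\<exists>S. finite S \<and> supports act S x)"

text \<open>
  The library's group actions on a carrier \<open>Y\<close> consist of functions that are extensional on
  \<open>Y\<close>. Restricting here, instead of demanding that \<open>act\<close> be extensional, puts no
  condition on \<open>act\<close> outside \<open>Y\<close>, so that the induced actions below need not mention
  the carrier.
\<close>

definition invariant_set :: "(('a \<Rightarrow> 'a) \<Rightarrow> 'b \<Rightarrow> 'b) \<Rightarrow> 'b set \<Rightarrow> bool"
  where "invariant_set act Y \<longleftrightarrow>
    group_action atom_perms Y (\<lambda>\<pi>. restrict (act \<pi>) Y) \<and> (\<forall>y\<in>Y. finitely_supported act y)"

definition set_act :: "(('a \<Rightarrow> 'a) \<Rightarrow> 'b \<Rightarrow> 'b) \<Rightarrow> ('a \<Rightarrow> 'a) \<Rightarrow> 'b set \<Rightarrow> 'b set"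
  where "set_act act \<pi> Z = act \<pi> ` Z"

definition prod_act ::
    "(('a \<Rightarrow> 'a) \<Rightarrow> 'b \<Rightarrow> 'b) \<Rightarrow> (('a \<Rightarrow> 'a) \<Rightarrow> 'c \<Rightarrow> 'c) \<Rightarrow> ('a \<Rightarrow> 'a) \<Rightarrow> 'b \<times> 'c \<Rightarrow> 'b \<times> 'c"
  where "prod_act act1 act2 \<pi> = map_prod (act1 \<pi>) (act2 \<pi>)"

definition sum_act ::
    "(('a \<Rightarrow> 'a) \<Rightarrow> 'b \<Rightarrow> 'b) \<Rightarrow> (('a \<Rightarrow> 'a) \<Rightarrow> 'c \<Rightarrow> 'c) \<Rightarrow> ('a \<Rightarrow> 'a) \<Rightarrow> 'b + 'c \<Rightarrow> 'b + 'c"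
  where "sum_act act1 act2 \<pi> = map_sum (act1 \<pi>) (act2 \<pi>)"

definition tuple_act :: "(('a \<Rightarrow> 'a) \<Rightarrow> 'b \<Rightarrow> 'b) \<Rightarrow> ('a \<Rightarrow> 'a) \<Rightarrow> 'b list \<Rightarrow> 'b list"
  where "tuple_act act \<pi> = map (act \<pi>)"

text \<open>
  If \<open>X\<close> is a finitely supported subset of an invariant set \<open>Y\<close>, then
  \<open>fs_Pow act X\<close> is the set of those elements of \<open>fs_Pow act Y\<close> that are contained
  in \<open>X\<close>; the ambient \<open>Y\<close> does not matter.
\<close>

definition fs_Pow :: "(('a \<Rightarrow> 'a) \<Rightarrow> 'b \<Rightarrow> 'b) \<Rightarrow> 'b set \<Rightarrow> 'b set set"
  where "fs_Pow act X = {Z \<in> Pow X. finitely_supported (set_act act) Z}"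

definition inj_tuples :: "'b set \<Rightarrow> 'b list set"
  where "inj_tuples X = {xs \<in> lists X. distinct xs}"

definition uniformly_supported :: "(('a \<Rightarrow> 'a) \<Rightarrow> 'b \<Rightarrow> 'b) \<Rightarrow> 'b set \<Rightarrow> bool"
  where "uniformly_supported act U \<longleftrightarrow> (\<exists>S. finite S \<and> (\<forall>x\<in>U. supports act S x))"

text \<open>Only meaningful if \<open>X\<close> is a finitely supported subset of an invariant set.\<close>

definition FSM_uniformly_infinite :: "(('a \<Rightarrow> 'a) \<Rightarrow> 'b \<Rightarrow> 'b) \<Rightarrow> 'b set \<Rightarrow> bool"
  where "FSM_uniformly_infinite act X \<longleftrightarrow>
    (\<exists>U. U \<subseteq> X \<and> infinite U \<and> uniformly_supported act U)"


text \<open>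
  The induced actions turn the induced carriers into invariant sets, and the sets that
  \<^const>\<open>FSM_uniformly_infinite\<close> is applied to are finitely supported subsets of these.
\<close>

lemma group_atom_perms: "group atom_perms"
  unfolding atom_perms_def
  by (rule groupI)
    (auto simp: permutation_compose comp_assoc intro!: exI[of _ "Hilbert_Choice.inv p" for p] permutation_inverse
      dest: permutation_bijective simp: bij_is_inj)

lemma Fix_iff: "\<pi> \<in> Fix S \<longleftrightarrow> permutation \<pi> \<and> (\<forall>a\<in>S. \<pi> a = a)"
  by (simp add: Fix_def atom_perms_def)

lemma Fix_antimono: "S \<subseteq> T \<Longrightarrow> Fix T \<subseteq> Fix S"
  unfolding Fix_iff subset_iff by blast

lemma permutation_inv_comp:
  "permutation \<pi> \<Longrightarrow> \<pi> \<circ> Hilbert_Choice.inv \<pi> = id" "permutation \<pi> \<Longrightarrow> Hilbert_Choice.inv \<pi> \<circ> \<pi> = id"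
  by (simp_all add: permutation_bijective bij_is_inj bij_is_surj flip: surj_iff)

lemma invariant_set_iff:
  fixes act :: "('a \<Rightarrow> 'a) \<Rightarrow> 'b \<Rightarrow> 'b"
  shows "invariant_set act Y \<longleftrightarrow>
    (\<forall>\<pi> y. permutation \<pi> \<longrightarrow> y \<in> Y \<longrightarrow> act \<pi> y \<in> Y) \<and>
    (\<forall>y\<in>Y. act id y = y) \<and>
    (\<forall>\<pi> \<sigma> y. permutation \<pi> \<longrightarrow> permutation \<sigma> \<longrightarrow> y \<in> Y \<longrightarrow> act (\<pi> \<circ> \<sigma>) y = act \<pi> (act \<sigma> y)) \<and>
    (\<forall>y\<in>Y. finitely_supported act y)" (is "_ \<longleftrightarrow> ?closed \<and> ?id \<and> ?comp \<and> ?supp")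
proof
  assume inv: "invariant_set act Y"
  then interpret group_action atom_perms Y "\<lambda>\<pi>. restrict (act \<pi>) Y"
    by (simp add: invariant_set_def)
  have closed: ?closed
  proof (intro allI impI)
    fix \<pi> :: "'a \<Rightarrow> 'a" and y assume "permutation \<pi>" "y \<in> Y"
    then show "act \<pi> y \<in> Y"
      using element_image[of \<pi> y] by (simp add: atom_perms_def)
  qed
  moreover have ?id
    using id_eq_one by (auto simp: atom_perms_def restrict_def fun_eq_iff split: if_splits)
  moreover have ?comp
  proof (intro allI impI)
    fix \<pi> \<sigma> :: "'a \<Rightarrow> 'a" and y assume "permutation \<pi>" "permutation \<sigma>" "y \<in> Y"
    then show "act (\<pi> \<circ> \<sigma>) y = act \<pi> (act \<sigma> y)"
      using composition_rule[of y \<pi> \<sigma>] closed by (simp add: atom_perms_def)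
  qed
  ultimately show "?closed \<and> ?id \<and> ?comp \<and> ?supp"
    using inv by (simp add: invariant_set_def)
next
  assume asm: "?closed \<and> ?id \<and> ?comp \<and> ?supp"
  have bij: "restrict (act \<pi>) Y \<in> Bij Y" if "permutation \<pi>" for \<pi> :: "'a \<Rightarrow> 'a"
  proof -
    have "bij_betw (act \<pi>) Y Y"
    proof (rule bij_betw_byWitness[where f' = "act (Hilbert_Choice.inv \<pi>)"])
      show "\<forall>y\<in>Y. act (Hilbert_Choice.inv \<pi>) (act \<pi> y) = y" "\<forall>y\<in>Y. act \<pi> (act (Hilbert_Choice.inv \<pi>) y) = y"
        using asm that permutation_inverse[OF that] permutation_inv_comp[OF that] by metis+
      show "act \<pi> ` Y \<subseteq> Y" "act (Hilbert_Choice.inv \<pi>) ` Y \<subseteq> Y"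
        using asm that permutation_inverse[OF that] by auto
    qed
    then show ?thesis by (simp add: Bij_def)
  qed
  have "(\<lambda>\<pi>. restrict (act \<pi>) Y) \<in> hom atom_perms (BijGroup Y)"
    unfolding hom_def
  proof (intro CollectI conjI ballI)
    show "(\<lambda>\<pi>. restrict (act \<pi>) Y) \<in> carrier atom_perms \<rightarrow> carrier (BijGroup Y)"
      using bij by (auto simp: atom_perms_def BijGroup_def)
    fix \<pi> \<sigma> :: "'a \<Rightarrow> 'a" assume "\<pi> \<in> carrier atom_perms" "\<sigma> \<in> carrier atom_perms"
    then have p: "permutation \<pi>" "permutation \<sigma>" by (simp_all add: atom_perms_def)
    show "restrict (act (\<pi> \<otimes>\<^bsub>atom_perms\<^esub> \<sigma>)) Y =
        restrict (act \<pi>) Y \<otimes>\<^bsub>BijGroup Y\<^esub> restrict (act \<sigma>) Y"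
      using p asm bij by (auto simp: atom_perms_def BijGroup_def compose_def fun_eq_iff)
  qed
  then show "invariant_set act Y"
    using asm group_atom_perms group_BijGroup[of Y]
    by (auto simp: invariant_set_def group_action_def group_hom_def group_hom_axioms_def)
qed

lemma supports_image:
  assumes comp: "\<And>\<pi> \<sigma>. permutation \<pi> \<Longrightarrow> permutation \<sigma> \<Longrightarrow> act (\<pi> \<circ> \<sigma>) y = act \<pi> (act \<sigma> y)"
    and \<pi>: "permutation \<pi>" and supp: "supports act S y"
  shows "supports act (\<pi> ` S) (act \<pi> y)"
  unfolding supports_def
proof
  fix \<sigma> assume "\<sigma> \<in> Fix (\<pi> ` S)"
  then have \<sigma>: "permutation \<sigma>" "\<And>a. a \<in> S \<Longrightarrow> \<sigma> (\<pi> a) = \<pi> a" by (auto simp: Fix_iff)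
  let ?\<tau> = "Hilbert_Choice.inv \<pi> \<circ> (\<sigma> \<circ> \<pi>)"
  have perm: "permutation (\<sigma> \<circ> \<pi>)" "permutation (Hilbert_Choice.inv \<pi>)" "permutation ?\<tau>"
    using \<sigma> \<pi> by (auto intro!: permutation_compose permutation_inverse)
  have "?\<tau> a = a" if "a \<in> S" for a
    using \<sigma>(2)[OF that] \<pi> by (simp add: permutation_bijective bij_is_inj)
  then have "act ?\<tau> y = y"
    using supp perm by (simp add: supports_def Fix_iff)
  moreover have "\<pi> \<circ> ?\<tau> = \<sigma> \<circ> \<pi>"
    using permutation_inv_comp(1)[OF \<pi>] by (simp flip: comp_assoc)
  ultimately show "act \<sigma> (act \<pi> y) = act \<pi> y"
    using comp \<pi> \<sigma>(1) perm by metis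
qed

lemma invariant_set_fs_Pow:
  assumes "invariant_set act Y"
  shows "invariant_set (set_act act) (fs_Pow act Y)"
proof -
  have c: "\<And>\<pi> y. permutation \<pi> \<Longrightarrow> y \<in> Y \<Longrightarrow> act \<pi> y \<in> Y"
    and i: "\<And>y. y \<in> Y \<Longrightarrow> act id y = y"
    and m: "\<And>\<pi> \<sigma> y. permutation \<pi> \<Longrightarrow> permutation \<sigma> \<Longrightarrow> y \<in> Y \<Longrightarrow> act (\<pi> \<circ> \<sigma>) y = act \<pi> (act \<sigma> y)"
    using assms by (auto simp: invariant_set_iff)
  have I: "set_act act id Z = Z" if "Z \<subseteq> Y" for Z
    using that i by (force simp: set_act_def)
  have M: "set_act act (\<pi> \<circ> \<sigma>) Z = set_act act \<pi> (set_act act \<sigma> Z)"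
    if "permutation \<pi>" "permutation \<sigma>" "Z \<subseteq> Y" for \<pi> \<sigma> Z
    using that m unfolding set_act_def image_image by (intro image_cong) auto
  have C: "set_act act \<pi> Z \<subseteq> Y" if "permutation \<pi>" "Z \<subseteq> Y" for \<pi> Z
    using that c by (auto simp: set_act_def)
  have F: "finitely_supported (set_act act) (set_act act \<pi> Z)"
    if \<pi>: "permutation \<pi>" and Z: "Z \<subseteq> Y" and fs: "finitely_supported (set_act act) Z" for \<pi> Z
  proof -
    obtain S where S: "finite S" "supports (set_act act) S Z"
      using fs by (auto simp: finitely_supported_def)
    have "supports (set_act act) (\<pi> ` S) (set_act act \<pi> Z)"
      using M[OF _ _ Z] \<pi> S(2) by (rule supports_image)
    then show ?thesis using S(1) by (auto simp: finitely_supported_def)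
  qed
  show ?thesis
    unfolding invariant_set_iff fs_Pow_def using I M C F by simp
qed

lemma invariant_set_prod:
  assumes "invariant_set act1 Y" "invariant_set act2 Z"
  shows "invariant_set (prod_act act1 act2) (Y \<times> Z)"
proof -
  have "finitely_supported (prod_act act1 act2) (y, z)" if yz: "y \<in> Y" "z \<in> Z" for y z
  proof -
    obtain S T where "finite S" "supports act1 S y" "finite T" "supports act2 T z"
      using assms yz unfolding invariant_set_iff finitely_supported_def by metis
    then have "finite (S \<union> T)" "supports (prod_act act1 act2) (S \<union> T) (y, z)"
      by (auto simp: supports_def prod_act_def Fix_iff)
    then show ?thesis unfolding finitely_supported_def by blast
  qed
  then show ?thesis
    using assms unfolding invariant_set_iff by (auto simp: prod_act_def)
qed

lemma invariant_set_sum: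
  assumes "invariant_set act1 Y" "invariant_set act2 Z"
  shows "invariant_set (sum_act act1 act2) (Y <+> Z)"
proof -
  have "finitely_supported (sum_act act1 act2) (Inl y)" if "finitely_supported act1 y" for y
    using that by (auto simp: finitely_supported_def supports_def sum_act_def)
  moreover have "finitely_supported (sum_act act1 act2) (Inr z)" if "finitely_supported act2 z" for z
    using that by (auto simp: finitely_supported_def supports_def sum_act_def)
  ultimately show ?thesis
    using assms unfolding invariant_set_iff by (auto simp: sum_act_def)
qed

lemma invariant_set_lists:
  assumes "invariant_set act Y"
  shows "invariant_set (tuple_act act) (lists Y)"
proof -
  have fs: "finitely_supported (tuple_act act) ys" if "ys \<in> lists Y" for ys
    using that
  proof (induction ys)
    case Nil
    then show ?case by (auto simp: finitely_supported_def supports_def tuple_act_def)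
  next
    case (Cons y ys)
    then obtain S T where "finite S" "supports (tuple_act act) S ys" "finite T" "supports act T y"
      using assms by (auto simp: invariant_set_iff finitely_supported_def)
    then have "finite (S \<union> T)" "supports (tuple_act act) (S \<union> T) (y # ys)"
      by (auto simp: supports_def tuple_act_def Fix_iff)
    then show ?case unfolding finitely_supported_def by blast
  qed
  have "map (act id) ys = ys" if "ys \<in> lists Y" for ys
    using that assms by (auto simp: invariant_set_iff intro!: map_idI)
  then show ?thesis
    using assms fs unfolding invariant_set_iff tuple_act_def by (auto simp: in_lists_conv_set)
qed

text \<open>
  To see that \<open>S\<close> supports a set \<open>Z\<close>, one inclusion suffices, because
  \<^term>\<open>Fix S\<close> is closed under inverses.
\<close>

lemma supports_set_actI:
  assumes inv: "invariant_set act Y" and "Z \<subseteq> Y"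
    and incl: "\<And>\<pi> z. \<pi> \<in> Fix S \<Longrightarrow> z \<in> Z \<Longrightarrow> act \<pi> z \<in> Z"
  shows "supports (set_act act) S Z"
  unfolding supports_def set_act_def
proof (intro ballI equalityI subsetI)
  fix \<pi> z assume \<pi>: "\<pi> \<in> Fix S"
  show "z \<in> Z" if "z \<in> act \<pi> ` Z" using that incl[OF \<pi>] by auto
  have p: "permutation \<pi>" "permutation (Hilbert_Choice.inv \<pi>)"
    using \<pi> by (simp_all add: Fix_iff permutation_inverse)
  have "Hilbert_Choice.inv \<pi> \<in> Fix S"
    using \<pi> p by (auto simp: Fix_iff inv_f_eq permutation_bijective bij_is_inj)
  moreover assume "z \<in> Z"
  moreover from this have "act \<pi> (act (Hilbert_Choice.inv \<pi>) z) = z"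
    using inv p permutation_inv_comp(1)[OF p(1)] \<open>Z \<subseteq> Y\<close>
    unfolding invariant_set_iff by (metis subsetD)
  ultimately show "z \<in> act \<pi> ` Z" using incl by (metis imageI)
qed

lemma fs_PowE:
  assumes "X \<in> fs_Pow act Y"
  obtains S where "X \<subseteq> Y" "finite S" "\<And>\<pi> x. \<pi> \<in> Fix S \<Longrightarrow> x \<in> X \<Longrightarrow> act \<pi> x \<in> X"
proof -
  obtain S where S: "X \<subseteq> Y" "finite S" "supports (set_act act) S X"
    using assms by (auto simp: fs_Pow_def finitely_supported_def)
  then have "\<And>\<pi>. \<pi> \<in> Fix S \<Longrightarrow> act \<pi> ` X = X"
    by (simp add: supports_def set_act_def)
  with S show ?thesis by (intro that) auto
qed

lemma fs_PowI:
  assumes "invariant_set act Y" "Z \<subseteq> Y" "finite S"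
    "\<And>\<pi> z. \<pi> \<in> Fix S \<Longrightarrow> z \<in> Z \<Longrightarrow> act \<pi> z \<in> Z"
  shows "Z \<in> fs_Pow act Y"
  using supports_set_actI[OF assms(1,2,4)] assms(2,3)
  by (auto simp: fs_Pow_def finitely_supported_def)

context
  fixes act :: "('a \<Rightarrow> 'a) \<Rightarrow> 'b \<Rightarrow> 'b" and Y
  assumes inv: "invariant_set act Y"
begin

lemma fs_Pow_in_fs_Pow:
  assumes "X \<in> fs_Pow act Y"
  shows "fs_Pow act X \<in> fs_Pow (set_act act) (fs_Pow act Y)"
proof -
  obtain S where S: "X \<subseteq> Y" "finite S" "\<And>\<pi> x. \<pi> \<in> Fix S \<Longrightarrow> x \<in> X \<Longrightarrow> act \<pi> x \<in> X"
    using assms by (elim fs_PowE) (rule that, auto)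
  have inv': "invariant_set (set_act act) (fs_Pow act Y)"
    using inv by (rule invariant_set_fs_Pow)
  have sub: "fs_Pow act X \<subseteq> fs_Pow act Y" using S(1) by (auto simp: fs_Pow_def)
  show ?thesis
  proof (rule fs_PowI[OF inv' sub S(2)])
    fix \<pi> Z assume "\<pi> \<in> Fix S" "Z \<in> fs_Pow act X"
    moreover from this have "set_act act \<pi> Z \<in> fs_Pow act Y"
      using inv' sub by (auto simp: invariant_set_iff Fix_iff)
    ultimately show "set_act act \<pi> Z \<in> fs_Pow act X"
      using S(3) by (auto simp: fs_Pow_def set_act_def)
  qed
qed

lemma Fpow_in_fs_Pow:
  assumes "X \<in> fs_Pow act Y"
  shows "Fpow X \<in> fs_Pow (set_act act) (fs_Pow act Y)"
proof -
  obtain S where S: "X \<subseteq> Y" "finite S" "\<And>\<pi> x. \<pi> \<in> Fix S \<Longrightarrow> x \<in> X \<Longrightarrow> act \<pi> x \<in> X"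
    using assms by (elim fs_PowE) (rule that, auto)
  have "F \<in> fs_Pow act Y" if F: "finite F" "F \<subseteq> Y" for F
  proof -
    have "\<forall>y\<in>F. \<exists>T. finite T \<and> supports act T y"
      using inv F by (auto simp: invariant_set_iff finitely_supported_def)
    then obtain T where T: "\<forall>y\<in>F. finite (T y) \<and> supports act (T y) y"
      by metis
    show ?thesis
    proof (rule fs_PowI[OF inv F(2)])
      show "finite (\<Union>y\<in>F. T y)" using F T by blast
      fix \<pi> y assume "\<pi> \<in> Fix (\<Union>y\<in>F. T y)" "y \<in> F"
      moreover from this have "\<pi> \<in> Fix (T y)" by (auto simp: Fix_iff)
      ultimately show "act \<pi> y \<in> F" using T by (auto simp: supports_def)
    qed
  qed
  then show ?thesis
    using S by (intro fs_PowI[OF invariant_set_fs_Pow[OF inv] _ S(2)])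
      (auto simp: Fpow_def set_act_def)
qed

lemma inj_tuples_in_fs_Pow:
  assumes "X \<in> fs_Pow act Y"
  shows "inj_tuples X \<in> fs_Pow (tuple_act act) (lists Y)"
proof -
  obtain S where S: "X \<subseteq> Y" "finite S" "\<And>\<pi> x. \<pi> \<in> Fix S \<Longrightarrow> x \<in> X \<Longrightarrow> act \<pi> x \<in> X"
    using assms by (elim fs_PowE) (rule that, auto)
  have inj: "inj_on (act \<pi>) Y" if "\<pi> \<in> Fix S" for \<pi>
  proof (rule inj_on_inverseI[where g = "act (Hilbert_Choice.inv \<pi>)"])
    fix y assume "y \<in> Y"
    then show "act (Hilbert_Choice.inv \<pi>) (act \<pi> y) = y"
      using inv that permutation_inv_comp(2)[of \<pi>] permutation_inverse[of \<pi>]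
      unfolding invariant_set_iff Fix_iff by metis
  qed
  show ?thesis
  proof (rule fs_PowI[OF invariant_set_lists[OF inv] _ S(2)])
    show "inj_tuples X \<subseteq> lists Y" using S(1) by (auto simp: inj_tuples_def)
    fix \<pi> xs assume \<pi>: "\<pi> \<in> Fix S" and xs: "xs \<in> inj_tuples X"
    then have "inj_on (act \<pi>) (set xs)"
      using inj S(1) by (auto simp: inj_tuples_def intro: inj_on_subset)
    then show "tuple_act act \<pi> xs \<in> inj_tuples X"
      using xs S(3)[OF \<pi>] by (auto simp: inj_tuples_def tuple_act_def distinct_map)
  qed
qed

lemma Times_in_fs_Pow:
  assumes "X1 \<in> fs_Pow act Y" "X2 \<in> fs_Pow act Y"
  shows "X1 \<times> X2 \<in> fs_Pow (prod_act act act) (Y \<times> Y)"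
proof -
  obtain S1 where S1: "X1 \<subseteq> Y" "finite S1" "\<And>\<pi> x. \<pi> \<in> Fix S1 \<Longrightarrow> x \<in> X1 \<Longrightarrow> act \<pi> x \<in> X1"
    using assms(1) by (elim fs_PowE) (rule that, auto)
  obtain S2 where S2: "X2 \<subseteq> Y" "finite S2" "\<And>\<pi> x. \<pi> \<in> Fix S2 \<Longrightarrow> x \<in> X2 \<Longrightarrow> act \<pi> x \<in> X2"
    using assms(2) by (elim fs_PowE) (rule that, auto)
  show ?thesis
    using S1 S2
    by (intro fs_PowI[OF invariant_set_prod[OF inv inv], where S = "S1 \<union> S2"])
      (auto simp: prod_act_def Fix_iff)
qed

lemma Plus_in_fs_Pow:
  assumes "X1 \<in> fs_Pow act Y" "X2 \<in> fs_Pow act Y"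
  shows "X1 <+> X2 \<in> fs_Pow (sum_act act act) (Y <+> Y)"
proof -
  obtain S1 where S1: "X1 \<subseteq> Y" "finite S1" "\<And>\<pi> x. \<pi> \<in> Fix S1 \<Longrightarrow> x \<in> X1 \<Longrightarrow> act \<pi> x \<in> X1"
    using assms(1) by (elim fs_PowE) (rule that, auto)
  obtain S2 where S2: "X2 \<subseteq> Y" "finite S2" "\<And>\<pi> x. \<pi> \<in> Fix S2 \<Longrightarrow> x \<in> X2 \<Longrightarrow> act \<pi> x \<in> X2"
    using assms(2) by (elim fs_PowE) (rule that, auto)
  show ?thesis
    using S1 S2
    by (intro fs_PowI[OF invariant_set_sum[OF inv inv], where S = "S1 \<union> S2"])
      (auto simp: sum_act_def Fix_iff)
qed

end

end

(*
  For (1) and (2), the cardinality of a set and the length of a tuple are unchanged by the action.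
  Hence whatever supports X supports all of the sets {F. F is a finite subset of X, |F| = n} and
  {t. t is an injective tuple over X of length n}; they are nonempty and pairwise disjoint, so
  there are infinitely many of them. For (3) and (4), a set S supports a pair iff it supports both
  components, and it supports Inl x or Inr y iff it supports x or y. An infinite subset of a product
  has an infinite projection, and an infinite subset of a sum has an infinite part in one summand.
*)

theory Submission
  imports Defs
begin

text \<open>The inverse permutation acts as a left inverse. Injectivity is what makes the induced
  action on subsets preserve cardinality.\<close>

lemma inj_on_act:
  assumes "invariant_set act Y" "permutation \<pi>"
  shows "inj_on (act \<pi>) Y"
proof (rule inj_on_inverseI[where g = "act (Hilbert_Choice.inv \<pi>)"])
  fix y assume "y \<in> Y"
  then show "act (Hilbert_Choice.inv \<pi>) (act \<pi> y) = y"
    using assms permutation_inv_comp(2)[of \<pi>] permutation_inverse[of \<pi>]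
    unfolding invariant_set_iff by metis
qed

lemma FSM_uniformly_infinite_mono:
  "FSM_uniformly_infinite act X \<Longrightarrow> X \<subseteq> Y \<Longrightarrow> FSM_uniformly_infinite act Y"
  unfolding FSM_uniformly_infinite_def by blast

lemma fs_Pow_mono: "X \<subseteq> Y \<Longrightarrow> fs_Pow act X \<subseteq> fs_Pow act Y"
  by (auto simp: fs_Pow_def)

text \<open>Common core of the powerset claims, to be used with \<open>card\<close> and
  \<open>length\<close> as \<open>f\<close>. Since \<open>f\<close> is constant along orbits, any
  \<open>S\<close> that supports \<open>X\<close> supports every fibre of \<open>f\<close> on
  \<open>X\<close>, so the fibres form a uniformly supported family.\<close>

lemma FSM_uniformly_infinite_fs_Pow:
  assumes inv: "invariant_set act Y" and X: "X \<in> fs_Pow act Y"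
    and f: "\<And>\<pi> y. permutation \<pi> \<Longrightarrow> y \<in> Y \<Longrightarrow> f (act \<pi> y) = f y"
    and inf: "infinite (f ` X)"
  shows "FSM_uniformly_infinite (set_act act) (fs_Pow act X)"
proof -
  obtain S where S: "X \<subseteq> Y" "finite S" "\<And>\<pi> x. \<pi> \<in> Fix S \<Longrightarrow> x \<in> X \<Longrightarrow> act \<pi> x \<in> X"
    using X by (elim fs_PowE) (rule that, auto)
  define fibre where "fibre n = {x \<in> X. f x = n}" for n
  have supp: "supports (set_act act) S (fibre n)" for n
  proof (rule supports_set_actI[OF inv])
    show "fibre n \<subseteq> Y" using S(1) by (auto simp: fibre_def)
    fix \<pi> x assume "\<pi> \<in> Fix S" "x \<in> fibre n"
    then show "act \<pi> x \<in> fibre n" using S f by (auto simp: fibre_def Fix_iff)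
  qed
  \<comment> \<open>Only values attained on \<open>X\<close> are taken, so each fibre is nonempty,
    and any element of it determines the value.\<close>
  have "inj_on fibre (f ` X)" by (rule inj_onI) (auto simp: fibre_def)
  then have "infinite (fibre ` f ` X)" using inf by (simp add: finite_image_iff)
  moreover have "fibre ` f ` X \<subseteq> fs_Pow act X"
    using supp S(2) by (auto simp: fs_Pow_def finitely_supported_def fibre_def)
  moreover have "uniformly_supported (set_act act) (fibre ` f ` X)"
    using supp S(2) by (auto simp: uniformly_supported_def)
  ultimately show ?thesis unfolding FSM_uniformly_infinite_def by blast
qed

lemma card_Fpow_infinite: "infinite X \<Longrightarrow> card ` Fpow X = UNIV"
proof (intro equalityI subsetI)
  fix n assume "infinite X"
  then obtain F where "F \<subseteq> X" "finite F" "card F = n"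
    using infinite_arbitrarily_large by metis
  then show "n \<in> card ` Fpow X" by (auto simp: Fpow_def)
qed simp

lemma length_inj_tuples_infinite: "infinite X \<Longrightarrow> length ` inj_tuples X = UNIV"
proof (intro equalityI subsetI)
  fix n assume "infinite X"
  then obtain F where F: "F \<subseteq> X" "finite F" "card F = n"
    using infinite_arbitrarily_large by metis
  then obtain xs where "set xs = F" "distinct xs"
    using finite_distinct_list by blast
  with F have "xs \<in> inj_tuples X" "length xs = n"
    by (auto simp: inj_tuples_def distinct_card)
  then show "n \<in> length ` inj_tuples X" by auto
qed simp

text \<open>The fibre argument is applied one level up: the ambient invariant set is
  \<open>fs_Pow act Y\<close>, and \<open>Fpow X\<close> plays the role of the subset.\<close>

lemma FSM_uniformly_infinite_Fpow:
  assumes inv: "invariant_set act Y" and "X \<in> fs_Pow act Y" "infinite X"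
  shows "FSM_uniformly_infinite (set_act (set_act act)) (fs_Pow (set_act act) (Fpow X))"
proof (rule FSM_uniformly_infinite_fs_Pow[where f = card])
  show "invariant_set (set_act act) (fs_Pow act Y)" using inv by (rule invariant_set_fs_Pow)
  show "Fpow X \<in> fs_Pow (set_act act) (fs_Pow act Y)" using assms by (intro Fpow_in_fs_Pow)
  show "infinite (card ` Fpow X)" using assms by (simp add: card_Fpow_infinite)
  \<comment> \<open>\<open>Z\<close> ranges over the whole ambient set and may be infinite;
    \<open>card\<close> is then 0 on both sides, and \<open>card_image\<close> covers this case
    too.\<close>
  fix \<pi> :: "'a \<Rightarrow> 'a" and Z assume "permutation \<pi>" "Z \<in> fs_Pow act Y"
  then have "inj_on (act \<pi>) Z"
    using inj_on_act[OF inv] by (auto simp: fs_Pow_def intro: inj_on_subset)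
  then show "card (set_act act \<pi> Z) = card Z" by (simp add: set_act_def card_image)
qed

lemma FSM_uniformly_infinite_inj_tuples:
  assumes "invariant_set act Y" "X \<in> fs_Pow act Y" "infinite X"
  shows "FSM_uniformly_infinite (set_act (tuple_act act)) (fs_Pow (tuple_act act) (inj_tuples X))"
  using assms
  by (intro FSM_uniformly_infinite_fs_Pow[where f = length, OF invariant_set_lists inj_tuples_in_fs_Pow])
    (auto simp: tuple_act_def length_inj_tuples_infinite)

text \<open>Transfers the claim about \<open>Fpow X\<close> to the full powerset
  \<open>fs_Pow act X\<close>. Finite support of a subset does not depend on the ambient set, so it
  can be read off from the membership of \<open>Fpow X\<close> in the iterated powerset of
  \<open>Y\<close>.\<close>

lemma Fpow_subset_fs_Pow:
  assumes "invariant_set act Y" "X \<in> fs_Pow act Y"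
  shows "Fpow X \<subseteq> fs_Pow act X"
  using Fpow_in_fs_Pow[OF assms] by (auto simp: fs_Pow_def Fpow_def)

text \<open>One \<open>S\<close> that supports all pairs in \<open>U\<close> supports all their
  components, so both projections of \<open>U\<close> are uniformly supported; it remains to find an
  infinite one.\<close>

lemma FSM_uniformly_infinite_Times:
  assumes "FSM_uniformly_infinite (prod_act act1 act2) (X \<times> Y)"
  shows "FSM_uniformly_infinite act1 X \<or> FSM_uniformly_infinite act2 Y"
proof -
  obtain U where U: "U \<subseteq> X \<times> Y" "infinite U" "uniformly_supported (prod_act act1 act2) U"
    using assms by (auto simp: FSM_uniformly_infinite_def)
  then obtain S where S: "finite S" "\<And>u. u \<in> U \<Longrightarrow> supports (prod_act act1 act2) S u"
    by (auto simp: uniformly_supported_def)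
  have supp: "supports act1 S (fst u) \<and> supports act2 S (snd u)" if "u \<in> U" for u
    using S(2)[OF that] by (cases u) (simp add: supports_def prod_act_def)
  have "uniformly_supported act1 (fst ` U)" "uniformly_supported act2 (snd ` U)"
    using supp S(1) by (auto simp: uniformly_supported_def)
  \<comment> \<open>Otherwise \<open>U\<close> would lie in the product of two finite sets.\<close>
  moreover have "infinite (fst ` U) \<or> infinite (snd ` U)"
    using U(2) finite_subset[OF subset_fst_snd[of U]] finite_cartesian_product[of "fst ` U" "snd ` U"]
    by argo
  moreover have "fst ` U \<subseteq> X" "snd ` U \<subseteq> Y" using U(1) by auto
  ultimately show ?thesis unfolding FSM_uniformly_infinite_def by blast
qed

lemma FSM_uniformly_infinite_Plus:
  assumes "FSM_uniformly_infinite (sum_act act1 act2) (X <+> Y)"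
  shows "FSM_uniformly_infinite act1 X \<or> FSM_uniformly_infinite act2 Y"
proof -
  obtain U where U: "U \<subseteq> X <+> Y" "infinite U" "uniformly_supported (sum_act act1 act2) U"
    using assms by (auto simp: FSM_uniformly_infinite_def)
  then obtain S where S: "finite S" "\<And>u. u \<in> U \<Longrightarrow> supports (sum_act act1 act2) S u"
    by (auto simp: uniformly_supported_def)
  have supp: "supports (sum_act act1 act2) S (Inl x) \<longleftrightarrow> supports act1 S x"
    "supports (sum_act act1 act2) S (Inr y) \<longleftrightarrow> supports act2 S y" for x y
    by (simp_all add: supports_def sum_act_def)
  have "uniformly_supported act1 (Inl -` U)" "uniformly_supported act2 (Inr -` U)"
    unfolding uniformly_supported_def using S(1)
      S(2)[of "Inl _", unfolded supp] S(2)[of "Inr _", unfolded supp] by auto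
  \<comment> \<open>The preimages under the injections are the two parts of \<open>U\<close>; if
    both were finite, so would be \<open>U\<close>.\<close>
  moreover have "U = (Inl -` U) <+> (Inr -` U)"
  proof (rule Set.set_eqI)
    show "x \<in> U \<longleftrightarrow> x \<in> (Inl -` U) <+> (Inr -` U)" for x by (cases x) auto
  qed
  then have "infinite (Inl -` U) \<or> infinite (Inr -` U)"
    using U(2) finite_Plus[of "Inl -` U" "Inr -` U"] by argo
  moreover have "Inl -` U \<subseteq> X" "Inr -` U \<subseteq> Y" using U(1) by auto
  ultimately show ?thesis unfolding FSM_uniformly_infinite_def by blast
qed

theorem theorem3p7:
  fixes act :: "('a \<Rightarrow> 'a) \<Rightarrow> 'b \<Rightarrow> 'b" and E :: "'b set"
  assumes "infinite (UNIV :: 'a set)"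
    and "invariant_set act E"
  shows
    "(\<forall>X \<in> fs_Pow act E. infinite X \<longrightarrow>
        FSM_uniformly_infinite (set_act (set_act act)) (fs_Pow (set_act act) (Fpow X)) \<and>
        FSM_uniformly_infinite (set_act (tuple_act act)) (fs_Pow (tuple_act act) (inj_tuples X))) \<and>
     (\<forall>X \<in> fs_Pow act E. infinite X \<longrightarrow>
        FSM_uniformly_infinite (set_act (set_act act)) (fs_Pow (set_act act) (fs_Pow act X))) \<and>
     (\<forall>X \<in> fs_Pow act E. \<forall>Y \<in> fs_Pow act E.
        \<not> FSM_uniformly_infinite act X \<longrightarrow> \<not> FSM_uniformly_infinite act Y \<longrightarrow>
        \<not> FSM_uniformly_infinite (prod_act act act) (X \<times> Y)) \<and>
     (\<forall>X \<in> fs_Pow act E. \<forall>Y \<in> fs_Pow act E.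
        \<not> FSM_uniformly_infinite act X \<longrightarrow> \<not> FSM_uniformly_infinite act Y \<longrightarrow>
        \<not> FSM_uniformly_infinite (sum_act act act) (X <+> Y))"
proof (intro conjI ballI impI)
  fix X assume X: "X \<in> fs_Pow act E" "infinite X"
  show Fpow: "FSM_uniformly_infinite (set_act (set_act act)) (fs_Pow (set_act act) (Fpow X))"
    using assms(2) X by (rule FSM_uniformly_infinite_Fpow)
  show "FSM_uniformly_infinite (set_act (tuple_act act)) (fs_Pow (tuple_act act) (inj_tuples X))"
    using assms(2) X by (rule FSM_uniformly_infinite_inj_tuples)
  show "FSM_uniformly_infinite (set_act (set_act act)) (fs_Pow (set_act act) (fs_Pow act X))"
    \<comment> \<open>The infinite family found over \<open>Fpow X\<close> also lies in the larger
      set, with the same action.\<close>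
    using Fpow fs_Pow_mono[OF Fpow_subset_fs_Pow[OF assms(2) X(1)]]
    by (rule FSM_uniformly_infinite_mono)
next
  fix X Y assume "\<not> FSM_uniformly_infinite act X" "\<not> FSM_uniformly_infinite act Y"
  then show "\<not> FSM_uniformly_infinite (prod_act act act) (X \<times> Y)"
    "\<not> FSM_uniformly_infinite (sum_act act act) (X <+> Y)"
    using FSM_uniformly_infinite_Times[of act act X Y] FSM_uniformly_infinite_Plus[of act act X Y]
    by argo+
qed

end
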